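(* Let $A$ be the vertex–arc incidence matrix of $G_d$, let $\succ$ be any term order, and let $\mathbf{c}=(c_{i,j})_{1\le i<j\le d}\in\mathbb{R}^n$ satisfy $c_{i,j}+c_{j,k}>c_{i,k}$ for all $i<j<k$ and $c_{i,l}+c_{j,k}>c_{i,k}+c_{j,l}$ for all $i<j<k<l$. Then the reduced Gröbner basis of $I_A$ with respect to $\succ_{\mathbf{c}}$ is $\{x_{i,j}x_{j,k}-x_{i,k}: i<j<k\}\cup\{x_{i,l}x_{j,k}-x_{i,k}x_{j,l}: i<j<k<l\}$.
   Context: $G_d$ has vertices $1,\dots,d$ and arcs $(i,j)$, $1\le i<j\le d$, directed from $i$ to $j$; $n=\binom d2$. Its vertex–arc incidence matrix $A$ has in the column of arc $(i,j)$ entry $1$ in row $i$, $-1$ in row $j$, $0$ elsewhere. $I_A=\langle\mathbf{x}^{\mathbf{u}}-\mathbf{x}^{\mathbf{v}}:A\mathbf{u}=A\mathbf{v},\ \mathbf{u},\mathbf{v}\in\mathbb{N}^n\rangle\subseteq k[x_{i,j}]$. The refinement $\succ_{\mathbf{c}}$ orders monomials by $\mathbf{x}^{\mathbf{u}}\succ_{\mathbf{c}}\mathbf{x}^{\mathbf{v}}$ iff $\mathbf{c}\cdot\mathbf{u}>\mathbf{c}\cdot\mathbf{v}$, or equality and $\mathbf{x}^{\mathbf{u}}\succ\mathbf{x}^{\mathbf{v}}$. Since $I_A$ is homogeneous for the positive grading $\deg x_{i,j}=j-i$, $\succ_{\mathbf{c}}$ acts as a term order on $I_A$ and reduced Gröbner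 bases with respect to it exist. *)

theory Defs
  imports
    Complex_Main
    "HOL-Library.Poly_Mapping"
    "HOL-Algebra.Ideal"
    "Graph_Theory.Pair_Digraph"
begin

section \<open>Polynomials in the variables of a set\<close>

text \<open>
  A monomial is its finitely supported exponent vector, so multiplication of monomials is addition
  of exponent vectors; a polynomial is a finitely supported family of coefficients, and the
  product of \<open>HOL-Library.Poly_Mapping\<close> is the usual (convolution) product.
\<close>

type_synonym 'x monomial = "'x \<Rightarrow>\<^sub>0 nat"
type_synonym ('x, 'k) mpoly = "'x monomial \<Rightarrow>\<^sub>0 'k"

definition monomials :: "'x set \<Rightarrow> 'x monomial set" where
  "monomials V = {u. Poly_Mapping.keys u \<subseteq> V}"

definition poly_ring :: "'x set \<Rightarrow> ('x, 'k::field) mpoly ring" where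
  "poly_ring V =
    \<lparr>carrier = {p. Poly_Mapping.keys p \<subseteq> monomials V}, monoid.mult = (*), one = 1, ring.zero = 0, add = (+)\<rparr>"

definition xpow :: "'x monomial \<Rightarrow> ('x, 'k::field) mpoly" where
  "xpow u = Poly_Mapping.single u 1"

definition xvar :: "'x \<Rightarrow> ('x, 'k::field) mpoly" where
  "xvar a = xpow (Poly_Mapping.single a 1)"

definition mono_dvd :: "'x monomial \<Rightarrow> 'x monomial \<Rightarrow> bool" where
  "mono_dvd u v \<longleftrightarrow> (\<exists>w. v = u + w)"

lemma cring_poly_ring: "cring (poly_ring V :: ('x, 'k::field) mpoly ring)"
proof -
  have mult: "Poly_Mapping.keys (p * q) \<subseteq> monomials V"
    if "Poly_Mapping.keys p \<subseteq> monomials V" "Poly_Mapping.keys q \<subseteq> monomials V" for p q :: "('x, 'k) mpoly"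
  proof
    fix m assume "m \<in> Poly_Mapping.keys (p * q)"
    then obtain u v where "u \<in> Poly_Mapping.keys p" "v \<in> Poly_Mapping.keys q" "m = u + v"
      using keys_mult[of p q] by blast
    then show "m \<in> monomials V"
      using that keys_add[of u v] unfolding monomials_def by blast
  qed
  have add: "Poly_Mapping.keys (p + q) \<subseteq> monomials V"
    if "Poly_Mapping.keys p \<subseteq> monomials V" "Poly_Mapping.keys q \<subseteq> monomials V" for p q :: "('x, 'k) mpoly"
    using that keys_add[of p q] by blast
  show ?thesis
  proof (rule cringI)
    show "abelian_group (poly_ring V :: ('x, 'k) mpoly ring)"
    proof (rule abelian_groupI)
      fix p :: "('x, 'k) mpoly" assume "p \<in> carrier (poly_ring V)"
      then show "\<exists>q\<in>carrier (poly_ring V). q \<oplus>\<^bsub>poly_ring V\<^esub> p = \<zero>\<^bsub>poly_ring V\<^esub>"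
        by (intro bexI[of _ "- p"]) (auto simp: poly_ring_def)
    qed (use add in \<open>auto simp: poly_ring_def algebra_simps\<close>)
    show "comm_monoid (poly_ring V :: ('x, 'k) mpoly ring)"
      by (rule comm_monoidI)
        (use mult in \<open>auto simp: poly_ring_def monomials_def mult_ac\<close>)
  qed (auto simp: poly_ring_def algebra_simps)
qed

section \<open>Monomial orders and Groebner bases\<close>

text \<open>Orders are given by their strict greater-than relation on the monomials in \<open>V\<close>.\<close>

definition term_order :: "'x set \<Rightarrow> ('x monomial \<Rightarrow> 'x monomial \<Rightarrow> bool) \<Rightarrow> bool" where
  "term_order V gt \<longleftrightarrow>
    (\<forall>u\<in>monomials V. \<not> gt u u) \<and>
    (\<forall>u\<in>monomials V. \<forall>v\<in>monomials V. \<forall>w\<in>monomials V. gt u v \<longrightarrow> gt v w \<longrightarrow> gt u w) \<and>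
    (\<forall>u\<in>monomials V. \<forall>v\<in>monomials V. u \<noteq> v \<longrightarrow> gt u v \<or> gt v u) \<and>
    (\<forall>u\<in>monomials V. \<forall>v\<in>monomials V. \<forall>w\<in>monomials V. gt u v \<longrightarrow> gt (u + w) (v + w)) \<and>
    (\<forall>u\<in>monomials V. u \<noteq> 0 \<longrightarrow> gt u 0)"

definition weight :: "('x \<Rightarrow> real) \<Rightarrow> 'x monomial \<Rightarrow> real" where
  "weight c u = (\<Sum>a\<in>Poly_Mapping.keys u. c a * real (Poly_Mapping.lookup u a))"

definition refine ::
  "('x \<Rightarrow> real) \<Rightarrow> ('x monomial \<Rightarrow> 'x monomial \<Rightarrow> bool) \<Rightarrow> 'x monomial \<Rightarrow> 'x monomial \<Rightarrow> bool" where
  "refine c gt u v \<longleftrightarrow> weight c u > weight c v \<or> (weight c u = weight c v \<and> gt u v)"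

definition initial :: "('x monomial \<Rightarrow> 'x monomial \<Rightarrow> bool) \<Rightarrow> ('x, 'k::field) mpoly \<Rightarrow> 'x monomial"
  where "initial gt f = (THE u. u \<in> Poly_Mapping.keys f \<and> (\<forall>v\<in>Poly_Mapping.keys f. v \<noteq> u \<longrightarrow> gt u v))"

definition initial_ideal ::
  "'x set \<Rightarrow> ('x monomial \<Rightarrow> 'x monomial \<Rightarrow> bool) \<Rightarrow> ('x, 'k::field) mpoly set \<Rightarrow> ('x, 'k) mpoly set"
  where "initial_ideal V gt F = Idl\<^bsub>poly_ring V\<^esub> {xpow (initial gt f) |f. f \<in> F \<and> f \<noteq> 0}"

definition groebner_basis ::
  "'x set \<Rightarrow> ('x monomial \<Rightarrow> 'x monomial \<Rightarrow> bool) \<Rightarrow> ('x, 'k::field) mpoly set \<Rightarrow>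
    ('x, 'k) mpoly set \<Rightarrow> bool" where
  "groebner_basis V gt I G \<longleftrightarrow>
    finite G \<and> G \<subseteq> I \<and> initial_ideal V gt G = initial_ideal V gt I"

text \<open>
  No monomial of an element \<open>g\<close> may be divisible by the initial monomial of an element \<open>h\<close>, apart
  from the initial monomial of \<open>g\<close> by itself. For a term order, the case \<open>h = g\<close> holds
  automatically. It has to be demanded for a refinement by a weight with negative entries, where a
  proper multiple of a monomial can be smaller than the monomial: if \<open>x\<close> has negative weight, both
  \<open>{x}\<close> and \<open>{x - x\<^sup>2}\<close> consist of monic elements of \<open>\<langle>x\<rangle>\<close> whose initial monomials generate the
  initial ideal, but only the former is reduced.
\<close>

definition reduced_groebner_basis ::
  "'x set \<Rightarrow> ('x monomial \<Rightarrow> 'x monomial \<Rightarrow> bool) \<Rightarrow> ('x, 'k::field) mpoly set \<Rightarrow>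
    ('x, 'k) mpoly set \<Rightarrow> bool" where
  "reduced_groebner_basis V gt I G \<longleftrightarrow>
    groebner_basis V gt I G \<and>
    (\<forall>g\<in>G. g \<noteq> 0 \<and> Poly_Mapping.lookup g (initial gt g) = 1 \<and>
      (\<forall>h\<in>G. \<forall>u\<in>Poly_Mapping.keys g. h \<noteq> g \<or> u \<noteq> initial gt g \<longrightarrow> \<not> mono_dvd (initial gt h) u))"

section \<open>The toric ideal of a digraph\<close>

definition acyclic_tournament :: "nat \<Rightarrow> nat pair_pre_digraph" where
  "acyclic_tournament d =
    \<lparr>pverts = {1..d}, parcs = {(i, j). 1 \<le> i \<and> i < j \<and> j \<le> d}\<rparr>"

definition incidence_matrix :: "'v pair_pre_digraph \<Rightarrow> 'v \<Rightarrow> 'v \<times> 'v \<Rightarrow> int" where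
  "incidence_matrix G v a =
    (if v = tail (with_proj G) a then 1 else if v = head (with_proj G) a then -1 else 0)"

text \<open>
  The matrix \<open>A\<close> has the rows \<open>R\<close> and the columns \<open>V\<close>; the latter are the variables of the ring.
\<close>

definition toric_ideal :: "'r set \<Rightarrow> 'x set \<Rightarrow> ('r \<Rightarrow> 'x \<Rightarrow> int) \<Rightarrow> ('x, 'k::field) mpoly set" where
  "toric_ideal R V A = Idl\<^bsub>poly_ring V\<^esub>
    {xpow u - xpow v |u v. u \<in> monomials V \<and> v \<in> monomials V \<and>
      (\<forall>r\<in>R. (\<Sum>a\<in>V. A r a * int (Poly_Mapping.lookup u a)) = (\<Sum>a\<in>V. A r a * int (Poly_Mapping.lookup v a)))}"

end

theory Submission
  imports Defs
begin

text \<open>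
  Call a monomial standard if no arc of its support ends where another one starts and no arc
  encloses another one without sharing an end with it; these are the monomials that no initial monomial of
  the binomials divides. Replacing a chain or a nested pair of arcs stays in the fibre
  \<open>{v. A v = A u}\<close> and decreases the weight, so every monomial that is not standard lies above a
  standard one of its fibre. A fibre contains only one standard monomial: the signs of the entries
  of \<open>A u\<close> determine the tails and the heads in its support, so two standard monomials share the
  arc from the least tail to the least head, which can be cancelled. Finally, \<open>I\<^sub>A\<close> is graded by
  the fibres: the coefficients of an element of \<open>I\<^sub>A\<close> sum to zero on each fibre, hence its initial
  monomial is not the least one of its fibre and is therefore not standard.
\<close>

section \<open>Polynomial mappings\<close>

text \<open>Natural exponents cannot cancel, so the inclusion \<open>keys_add\<close> becomes an
  equality.\<close>

lemma keys_plus_nat: "Poly_Mapping.keys (u + v) = Poly_Mapping.keys u \<union> Poly_Mapping.keys v"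
  for u v :: "'x monomial"
  by (auto simp: in_keys_iff lookup_add)

lemma add_in_monomials_iff [simp]:
  "u + v \<in> monomials V \<longleftrightarrow> u \<in> monomials V \<and> v \<in> monomials V"
  by (simp add: monomials_def keys_plus_nat)

lemma sum_single_lookup:
  "(\<Sum>u\<in>Poly_Mapping.keys p. Poly_Mapping.single u (Poly_Mapping.lookup p u)) = p"
  by (rule poly_mapping_eqI) (simp add: lookup_sum lookup_single when_def in_keys_iff)

lemma split_single:
  fixes u :: "'x monomial"
  assumes "a \<in> Poly_Mapping.keys u"
  obtains w where "u = Poly_Mapping.single a 1 + w"
proof
  show "u = Poly_Mapping.single a 1 + (u - Poly_Mapping.single a 1)"
    using assms
    by (intro poly_mapping_eqI)
      (auto simp: lookup_add lookup_minus lookup_single when_def in_keys_iff)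
qed

lemma split_two_singles:
  fixes u :: "'x monomial"
  assumes "a \<in> Poly_Mapping.keys u" "b \<in> Poly_Mapping.keys u" "a \<noteq> b"
  obtains w where "u = Poly_Mapping.single a 1 + Poly_Mapping.single b 1 + w"
proof -
  obtain w where w: "u = Poly_Mapping.single a 1 + w"
    using assms(1) by (rule split_single)
  with assms have "b \<in> Poly_Mapping.keys w"
    by (simp add: keys_plus_nat)
  then obtain w' where "w = Poly_Mapping.single b 1 + w'"
    by (rule split_single)
  with w that show thesis
    by (simp add: add.assoc)
qed

lemma mono_dvd_trans: "mono_dvd u v \<Longrightarrow> mono_dvd v w \<Longrightarrow> mono_dvd u w"
  unfolding mono_dvd_def by (metis add.assoc)

lemma mono_dvd_antisym:
  assumes "mono_dvd u v" "mono_dvd v u"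
  shows "u = v"
proof -
  from assms obtain w w' where "v = u + w" "u = v + w'"
    by (auto simp: mono_dvd_def)
  then show ?thesis
    by (intro poly_mapping_eqI) (metis lookup_add add_leE le_add1 order_antisym)
qed

lemma mono_dvd_keys: "mono_dvd u v \<Longrightarrow> Poly_Mapping.keys u \<subseteq> Poly_Mapping.keys v"
  by (auto simp: mono_dvd_def keys_plus_nat)

section \<open>Ideals generated by monomials\<close>

text \<open>Meant for the sets that bound a generated ideal from above. Closure under negation comes
  from multiplication by \<open>- 1\<close>, which lies in the ring for every
  \<open>V\<close>.\<close>

lemma ideal_poly_ringI:
  fixes S :: "('x, 'k::field) mpoly set"
  assumes carrier: "S \<subseteq> carrier (poly_ring V)"
    and zero: "0 \<in> S"
    and add: "\<And>p q. p \<in> S \<Longrightarrow> q \<in> S \<Longrightarrow> p + q \<in> S"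
    and mult: "\<And>p q. p \<in> carrier (poly_ring V) \<Longrightarrow> q \<in> S \<Longrightarrow> p * q \<in> S"
  shows "ideal S (poly_ring V)"
proof -
  interpret R: cring "poly_ring V :: ('x, 'k) mpoly ring"
    by (rule cring_poly_ring)
  have minus: "\<ominus>\<^bsub>poly_ring V\<^esub> p = - p" if "p \<in> carrier (poly_ring V)" for p :: "('x, 'k) mpoly"
    by (rule R.minus_equality) (use that in \<open>auto simp: poly_ring_def\<close>)
  have neg: "- p \<in> S" if "p \<in> S" for p
    using mult[OF _ that, of "- 1"] by (simp add: poly_ring_def monomials_def)
  show ?thesis
  proof (rule idealI)
    show "ring (poly_ring V :: ('x, 'k) mpoly ring)"
      by (rule R.ring_axioms)
    show "subgroup S (add_monoid (poly_ring V))"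
    proof (rule R.add.subgroupI)
      show "S \<noteq> {}"
        using zero by blast
      show "\<ominus>\<^bsub>poly_ring V\<^esub> p \<in> S" if "p \<in> S" for p
        using that carrier minus neg by (metis subsetD)
      show "p \<oplus>\<^bsub>poly_ring V\<^esub> q \<in> S" if "p \<in> S" "q \<in> S" for p q
        using that add by (simp add: poly_ring_def)
    qed (use carrier in auto)
    show "x \<otimes>\<^bsub>poly_ring V\<^esub> a \<in> S" "a \<otimes>\<^bsub>poly_ring V\<^esub> x \<in> S"
      if "a \<in> S" "x \<in> carrier (poly_ring V)" for a x
      using mult[OF that(2,1)] by (simp_all add: poly_ring_def mult.commute)
  qed
qed

lemma ideal_poly_ring_diff:
  fixes I :: "('x, 'k::field) mpoly set"
  assumes "ideal I (poly_ring V)" "p \<in> I" "q \<in> I"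
  shows "p - q \<in> I"
proof -
  interpret ideal I "poly_ring V" by fact
  have "- 1 * q \<in> I"
    using I_l_closed[OF assms(3), of "- 1"] by (simp add: poly_ring_def monomials_def)
  with additive_subgroup.a_closed[OF is_additive_subgroup assms(2), of "- q"] show ?thesis
    by (simp add: poly_ring_def)
qed

lemma xpow_in_carrier [simp]: "xpow u \<in> carrier (poly_ring V) \<longleftrightarrow> u \<in> monomials V"
  by (simp add: xpow_def poly_ring_def)

text \<open>The polynomials all of whose monomials are multiples of elements of \<open>M\<close>
  form an ideal that contains the generators, hence the generated ideal. Conversely,
  \<open>m + w\<close> is the exponent of the product of \<open>xpow m\<close> and
  \<open>xpow w\<close>.\<close>

lemma xpow_in_monomial_ideal_iff:
  assumes M: "M \<subseteq> monomials V" and u: "u \<in> monomials V"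
  shows "(xpow u :: ('x, 'k::field) mpoly) \<in> Idl\<^bsub>poly_ring V\<^esub> (xpow ` M) \<longleftrightarrow>
    (\<exists>m\<in>M. mono_dvd m u)"
proof
  interpret R: cring "poly_ring V :: ('x, 'k) mpoly ring"
    by (rule cring_poly_ring)
  have gens: "xpow ` M \<subseteq> carrier (poly_ring V :: ('x, 'k) mpoly ring)"
    using M by auto
  let ?S = "{p \<in> carrier (poly_ring V :: ('x, 'k) mpoly ring).
    \<forall>v\<in>Poly_Mapping.keys p. \<exists>m\<in>M. mono_dvd m v}"
  have "ideal ?S (poly_ring V)"
  proof (rule ideal_poly_ringI)
    show "p + q \<in> ?S" if "p \<in> ?S" "q \<in> ?S" for p q
      using that R.a_closed[of p q] keys_add[of p q] by (auto simp: poly_ring_def)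
    show "p * q \<in> ?S" if pq: "p \<in> carrier (poly_ring V)" "q \<in> ?S" for p q
    proof -
      have "\<exists>m\<in>M. mono_dvd m w" if "w \<in> Poly_Mapping.keys (p * q)" for w
      proof -
        from that keys_mult[of p q] obtain v v' where
          "w = v + v'" "v' \<in> Poly_Mapping.keys q"
          by blast
        then have "mono_dvd v' w" "\<exists>m\<in>M. mono_dvd m v'"
          using pq(2) by (auto simp: mono_dvd_def add.commute)
        then show ?thesis
          using mono_dvd_trans by blast
      qed
      then show ?thesis
        using pq R.m_closed[of p q] by (auto simp: poly_ring_def)
    qed
  qed (auto simp: poly_ring_def)
  moreover have "xpow ` M \<subseteq> ?S"
    using M by (auto simp: xpow_def poly_ring_def mono_dvd_def intro!: bexI exI[of _ 0])
  ultimately have "Idl\<^bsub>poly_ring V\<^esub> (xpow ` M) \<subseteq> ?S"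
    by (rule R.genideal_minimal)
  then show "\<exists>m\<in>M. mono_dvd m u" if "(xpow u :: ('x, 'k) mpoly) \<in> Idl\<^bsub>poly_ring V\<^esub> (xpow ` M)"
    using that by (auto simp: xpow_def)
  assume "\<exists>m\<in>M. mono_dvd m u"
  then obtain m w where mw: "m \<in> M" "u = m + w"
    by (auto simp: mono_dvd_def)
  have "(xpow m :: ('x, 'k) mpoly) \<in> Idl\<^bsub>poly_ring V\<^esub> (xpow ` M)"
    using R.genideal_self[OF gens] mw(1) by blast
  then have "xpow m \<otimes>\<^bsub>poly_ring V\<^esub> (xpow w :: ('x, 'k) mpoly) \<in> Idl\<^bsub>poly_ring V\<^esub> (xpow ` M)"
    using u mw by (intro ideal.I_r_closed[OF R.genideal_ideal[OF gens]]) auto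
  moreover have "xpow m \<otimes>\<^bsub>poly_ring V\<^esub> (xpow w :: ('x, 'k) mpoly) = xpow u"
    by (simp add: poly_ring_def xpow_def mult_single mw(2))
  ultimately show "(xpow u :: ('x, 'k) mpoly) \<in> Idl\<^bsub>poly_ring V\<^esub> (xpow ` M)"
    by simp
qed

section \<open>Initial monomials and reduced Groebner bases\<close>

text \<open>The refinement by \<open>c\<close> need not be a term order: with a negative weight a
  variable can lie below 1. It is still a strict linear order, which gives every nonzero polynomial
  an initial monomial because supports are finite.\<close>

locale monomial_order =
  fixes V :: "'x set" and gt :: "'x monomial \<Rightarrow> 'x monomial \<Rightarrow> bool"
  assumes irrefl: "u \<in> monomials V \<Longrightarrow> \<not> gt u u"
    and trans: "u \<in> monomials V \<Longrightarrow> v \<in> monomials V \<Longrightarrow> w \<in> monomials V \<Longrightarrow>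
      gt u v \<Longrightarrow> gt v w \<Longrightarrow> gt u w"
    and total: "u \<in> monomials V \<Longrightarrow> v \<in> monomials V \<Longrightarrow> u \<noteq> v \<Longrightarrow> gt u v \<or> gt v u"
begin

lemma initial_eqI:
  assumes "u \<in> Poly_Mapping.keys f" "\<And>v. v \<in> Poly_Mapping.keys f \<Longrightarrow> v \<noteq> u \<Longrightarrow> gt u v"
    and "Poly_Mapping.keys f \<subseteq> monomials V"
  shows "initial gt f = u"
  unfolding initial_def
proof (rule the_equality)
  show "w = u" if "w \<in> Poly_Mapping.keys f \<and> (\<forall>v\<in>Poly_Mapping.keys f. v \<noteq> w \<longrightarrow> gt w v)" for w
    using that assms irrefl trans by (metis subsetD)
qed (use assms in auto)

lemma finite_has_greatest:
  assumes "finite S" "S \<noteq> {}" "S \<subseteq> monomials V"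
  shows "\<exists>u\<in>S. \<forall>v\<in>S. v \<noteq> u \<longrightarrow> gt u v"
  using assms
proof (induction S rule: finite_ne_induct)
  case (insert x S)
  then obtain u where u: "u \<in> S" "\<forall>v\<in>S. v \<noteq> u \<longrightarrow> gt u v"
    by auto
  show ?case
  proof (cases "gt x u")
    case True
    with u insert.prems show ?thesis
      by (intro bexI[of _ x]) (auto, metis subsetD trans)
  next
    case False
    with u insert have "gt u x"
      using total[of x u] by auto
    with u show ?thesis
      by auto
  qed
qed auto

lemma initial_greatest:
  assumes "f \<noteq> 0" "Poly_Mapping.keys f \<subseteq> monomials V"
  shows "initial gt f \<in> Poly_Mapping.keys f"
    and "v \<in> Poly_Mapping.keys f \<Longrightarrow> v \<noteq> initial gt f \<Longrightarrow> gt (initial gt f) v"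
proof -
  obtain u where "u \<in> Poly_Mapping.keys f" "\<forall>v\<in>Poly_Mapping.keys f. v \<noteq> u \<longrightarrow> gt u v"
    using finite_has_greatest[of "Poly_Mapping.keys f"] assms by auto
  moreover from this have "initial gt f = u"
    using assms by (intro initial_eqI) auto
  ultimately show "initial gt f \<in> Poly_Mapping.keys f"
    and "v \<in> Poly_Mapping.keys f \<Longrightarrow> v \<noteq> initial gt f \<Longrightarrow> gt (initial gt f) v"
    by auto
qed

lemma initial_binomial:
  assumes "u \<in> monomials V" "v \<in> monomials V" "gt u v"
  shows "Poly_Mapping.keys (xpow u - xpow v :: ('x, 'k::field) mpoly) = {u, v}"
    and "Poly_Mapping.lookup (xpow u - xpow v :: ('x, 'k) mpoly) u = 1"
    and "initial gt (xpow u - xpow v :: ('x, 'k) mpoly) = u"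
proof -
  have "u \<noteq> v"
    using assms irrefl by blast
  then show keys: "Poly_Mapping.keys (xpow u - xpow v :: ('x, 'k::field) mpoly) = {u, v}"
    and "Poly_Mapping.lookup (xpow u - xpow v :: ('x, 'k) mpoly) u = 1"
    by (auto simp: in_keys_iff lookup_minus xpow_def lookup_single when_def split: if_splits)
  show "initial gt (xpow u - xpow v :: ('x, 'k) mpoly) = u"
    using assms by (intro initial_eqI) (auto simp: keys)
qed

lemma xpow_in_initial_ideal_iff:
  fixes F :: "('x, 'k::field) mpoly set"
  assumes F: "F \<subseteq> carrier (poly_ring V)" and u: "u \<in> monomials V"
  shows "(xpow u :: ('x, 'k) mpoly) \<in> initial_ideal V gt F \<longleftrightarrow>
    (\<exists>f\<in>F. f \<noteq> 0 \<and> mono_dvd (initial gt f) u)"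
proof -
  have "initial gt ` {f \<in> F. f \<noteq> 0} \<subseteq> monomials V"
    using initial_greatest(1) F by (force simp: poly_ring_def)
  moreover have "{xpow (initial gt f) |f. f \<in> F \<and> f \<noteq> 0} =
      (xpow ` initial gt ` {f \<in> F. f \<noteq> 0} :: ('x, 'k) mpoly set)"
    by auto
  ultimately show ?thesis
    by (simp add: initial_ideal_def xpow_in_monomial_ideal_iff[OF _ u] Bex_def conj_assoc)
qed

text \<open>Initial ideals are generated by monomials, so their equality comes down to divisibility
  of initial monomials.\<close>

lemma groebner_basisI:
  fixes I G :: "('x, 'k::field) mpoly set"
  assumes "finite G" "G \<subseteq> I" and I: "I \<subseteq> carrier (poly_ring V)"
    and dvd: "\<And>f. f \<in> I \<Longrightarrow> f \<noteq> 0 \<Longrightarrow>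
      \<exists>g\<in>G. g \<noteq> 0 \<and> mono_dvd (initial gt g) (initial gt f)"
  shows "groebner_basis V gt I G"
proof -
  interpret R: cring "poly_ring V :: ('x, 'k) mpoly ring"
    by (rule cring_poly_ring)
  have initial: "initial gt f \<in> monomials V" if "f \<in> I" "f \<noteq> 0" for f
    using initial_greatest(1)[of f] that I by (auto simp: poly_ring_def)
  have gens: "{xpow (initial gt f) |f. f \<in> F \<and> f \<noteq> 0} \<subseteq> carrier (poly_ring V :: ('x, 'k) mpoly ring)"
    if "F \<subseteq> I" for F
    using initial that by auto
  have "initial_ideal V gt I \<subseteq> initial_ideal V gt G"
    unfolding initial_ideal_def[of _ _ I]
  proof (rule R.genideal_minimal)
    show "ideal (initial_ideal V gt G) (poly_ring V)"
      unfolding initial_ideal_def using gens[OF assms(2)] by (rule R.genideal_ideal)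
    show "{xpow (initial gt f) |f. f \<in> I \<and> f \<noteq> 0} \<subseteq> initial_ideal V gt G"
    proof clarify
      fix f assume f: "f \<in> I" "f \<noteq> 0"
      have "G \<subseteq> carrier (poly_ring V)"
        using assms(2) I by (rule order_trans)
      from xpow_in_initial_ideal_iff[OF this initial[OF f]] dvd[OF f]
      show "xpow (initial gt f) \<in> initial_ideal V gt G"
        by (rule iffD2)
    qed
  qed
  moreover have "initial_ideal V gt G \<subseteq> initial_ideal V gt I"
    unfolding initial_ideal_def[of _ _ G]
  proof (rule R.genideal_minimal)
    show "ideal (initial_ideal V gt I) (poly_ring V)"
      unfolding initial_ideal_def using gens[OF order_refl] by (rule R.genideal_ideal)
    show "{xpow (initial gt f) |f. f \<in> G \<and> f \<noteq> 0} \<subseteq> initial_ideal V gt I"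
      unfolding initial_ideal_def using R.genideal_self[OF gens[OF order_refl]] assms(2) by blast
  qed
  ultimately show ?thesis
    using assms(1,2) by (auto simp: groebner_basis_def)
qed

text \<open>The converse of \<open>groebner_basisI\<close>: the initial monomial of \<open>f\<close>
  lies in the initial ideal of \<open>G\<close>, where membership of a monomial means divisibility
  by a generator.\<close>

lemma groebner_basis_dvd:
  fixes I G :: "('x, 'k::field) mpoly set"
  assumes "groebner_basis V gt I G" and I: "I \<subseteq> carrier (poly_ring V)" and f: "f \<in> I" "f \<noteq> 0"
  shows "\<exists>g\<in>G. g \<noteq> 0 \<and> mono_dvd (initial gt g) (initial gt f)"
proof -
  have G: "G \<subseteq> I" "initial_ideal V gt G = initial_ideal V gt I"
    using assms(1) by (auto simp: groebner_basis_def)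
  have u: "initial gt f \<in> monomials V"
    using initial_greatest(1)[of f] f I by (auto simp: poly_ring_def)
  have "(xpow (initial gt f) :: ('x, 'k) mpoly) \<in> initial_ideal V gt I"
    using f u I by (subst xpow_in_initial_ideal_iff) (auto simp: mono_dvd_def intro!: exI[of _ 0] bexI[of _ f])
  then show ?thesis
    using xpow_in_initial_ideal_iff[of G, OF _ u] G I by auto
qed

text \<open>An initial monomial of \<open>G\<close> is divisible by one of \<open>H\<close>, and
  that one again by one of \<open>G\<close>; reducedness makes all three equal. The difference of
  the two monic elements then loses this monomial, while its own initial monomial would be a
  forbidden multiple inside one of them.\<close>

lemma reduced_groebner_basis_subset:
  fixes I G H :: "('x, 'k::field) mpoly set"
  assumes I: "ideal I (poly_ring V)"
    and G: "reduced_groebner_basis V gt I G" and H: "reduced_groebner_basis V gt I H"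
  shows "G \<subseteq> H"
proof
  fix g assume g: "g \<in> G"
  have carrier: "I \<subseteq> carrier (poly_ring V)"
    using additive_subgroup.a_subset[OF ideal.axioms(1)[OF I]] .
  then have keys: "Poly_Mapping.keys f \<subseteq> monomials V" if "f \<in> I" for f
    using that by (auto simp: poly_ring_def)
  have GB: "groebner_basis V gt I G" "groebner_basis V gt I H" and sub: "G \<subseteq> I" "H \<subseteq> I"
    using G H by (auto simp: reduced_groebner_basis_def groebner_basis_def)
  have reduced: "h' = h \<and> u = initial gt h"
    if "h \<in> B" "h' \<in> B" "u \<in> Poly_Mapping.keys h" "mono_dvd (initial gt h') u" "B = G \<or> B = H"
    for B h h' u
    using that G H unfolding reduced_groebner_basis_def by blast
  have monic: "h \<noteq> 0" "Poly_Mapping.lookup h (initial gt h) = 1" if "h \<in> G \<union> H" for h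
    using that G H unfolding reduced_groebner_basis_def by blast+
  have gI: "g \<in> I" "g \<noteq> 0"
    using g sub monic(1) by auto
  obtain h where h: "h \<in> H" "mono_dvd (initial gt h) (initial gt g)"
    using groebner_basis_dvd[OF GB(2) carrier gI] by blast
  then have hI: "h \<in> I" "h \<noteq> 0"
    using sub monic(1) by auto
  obtain g' where g': "g' \<in> G" "mono_dvd (initial gt g') (initial gt h)"
    using groebner_basis_dvd[OF GB(1) carrier hI] by blast
  have "g' = g"
    using reduced[OF g g'(1) initial_greatest(1)[OF gI(2) keys[OF gI(1)]]] mono_dvd_trans[OF g'(2) h(2)]
    by blast
  with g'(2) h(2) have same: "initial gt h = initial gt g"
    by (simp add: mono_dvd_antisym)
  have "g = h"
  proof (rule ccontr)
    assume "g \<noteq> h"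
    then have f: "g - h \<in> I" "g - h \<noteq> 0"
      using ideal_poly_ring_diff[OF I gI(1) hI(1)] by auto
    define w where "w = initial gt (g - h)"
    have w: "w \<in> Poly_Mapping.keys (g - h)"
      unfolding w_def using initial_greatest(1)[OF f(2) keys[OF f(1)]] .
    \<comment> \<open>Both coefficients at the common initial monomial are 1 and cancel.\<close>
    then have w_ne: "w \<noteq> initial gt g"
      using monic(2)[of g] monic(2)[of h] g h(1) same by (auto simp: in_keys_iff lookup_minus)
    from w have "w \<in> Poly_Mapping.keys g \<or> w \<in> Poly_Mapping.keys h"
      by (auto simp: in_keys_iff lookup_minus)
    \<comment> \<open>Initial monomials from both bases divide \<open>w\<close>. Whichever of
      \<open>g\<close> and \<open>h\<close> contains \<open>w\<close>, reducedness of its own basis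
      makes \<open>w\<close> its initial monomial, contrary to \<open>w_ne\<close>.\<close>
    moreover obtain g'' where "g'' \<in> G" "mono_dvd (initial gt g'') w"
      using groebner_basis_dvd[OF GB(1) carrier f] w_def by blast
    moreover obtain h'' where "h'' \<in> H" "mono_dvd (initial gt h'') w"
      using groebner_basis_dvd[OF GB(2) carrier f] w_def by blast
    ultimately show False
      using reduced g h(1) w_ne same by metis
  qed
  with h(1) show "g \<in> H"
    by simp
qed

lemma reduced_groebner_basis_unique:
  assumes "ideal I (poly_ring V)" "reduced_groebner_basis V gt I G" "reduced_groebner_basis V gt I H"
  shows "G = H"
  using assms reduced_groebner_basis_subset by blast

end

section \<open>Fibres of a toric ideal\<close>

text \<open>The coefficients range over a semiring so that the integer rows of \<open>A\<close>, the
  real weight and the natural-valued measures used for induction are all instances.\<close>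

definition linear_form :: "'x set \<Rightarrow> ('x \<Rightarrow> 'b::comm_semiring_1) \<Rightarrow> 'x monomial \<Rightarrow> 'b" where
  "linear_form V f u = (\<Sum>a\<in>V. f a * of_nat (Poly_Mapping.lookup u a))"

lemma linear_form_add [simp]: "linear_form V f (u + v) = linear_form V f u + linear_form V f v"
  by (simp add: linear_form_def lookup_add distrib_left sum.distrib)

lemma linear_form_single [simp]:
  "finite V \<Longrightarrow> a \<in> V \<Longrightarrow> linear_form V f (Poly_Mapping.single a 1) = f a"
  by (simp add: linear_form_def lookup_single when_def if_distrib cong: if_cong)

lemma weight_eq_linear_form:
  assumes "finite V" "u \<in> monomials V"
  shows "weight c u = linear_form V c u"
  unfolding weight_def linear_form_def
  by (rule sum.mono_neutral_left) (use assms in \<open>auto simp: monomials_def in_keys_iff\<close>)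

definition same_fibre :: "'r set \<Rightarrow> 'x set \<Rightarrow> ('r \<Rightarrow> 'x \<Rightarrow> int) \<Rightarrow> 'x monomial \<Rightarrow> 'x monomial \<Rightarrow> bool" where
  "same_fibre R V A u v \<longleftrightarrow> (\<forall>r\<in>R. linear_form V (A r) u = linear_form V (A r) v)"

lemma toric_ideal_eq:
  "toric_ideal R V A =
    Idl\<^bsub>poly_ring V\<^esub> {xpow u - xpow v |u v. u \<in> monomials V \<and> v \<in> monomials V \<and> same_fibre R V A u v}"
  by (simp add: toric_ideal_def same_fibre_def linear_form_def)

lemma toric_generators_in_carrier:
  "{xpow u - xpow v |u v. u \<in> monomials V \<and> v \<in> monomials V \<and> same_fibre R V A u v}
    \<subseteq> carrier (poly_ring V :: ('x, 'k::field) mpoly ring)"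
proof -
  have "Poly_Mapping.keys (xpow u - xpow v :: ('x, 'k) mpoly) \<subseteq> {u, v}" for u v
    by (auto simp: in_keys_iff lookup_minus xpow_def lookup_single when_def split: if_splits)
  then show ?thesis
    by (fastforce simp: poly_ring_def)
qed

lemma ideal_toric_ideal: "ideal (toric_ideal R V A :: ('x, 'k::field) mpoly set) (poly_ring V)"
  unfolding toric_ideal_eq
  by (intro ring.genideal_ideal cring.axioms(1) cring_poly_ring toric_generators_in_carrier)

lemma binomial_in_toric_ideal:
  assumes "u \<in> monomials V" "v \<in> monomials V" "same_fibre R V A u v"
  shows "xpow u - xpow v \<in> (toric_ideal R V A :: ('x, 'k::field) mpoly set)"
  unfolding toric_ideal_eq
  using ring.genideal_self[OF cring.axioms(1)[OF cring_poly_ring] toric_generators_in_carrier] assms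
  by blast

section \<open>Coefficient sums over unions of fibres\<close>

text \<open>A linear functional that vanishes on the toric ideal when \<open>C\<close> is a union of
  fibres. It expresses the grading by fibres without homogeneous components.\<close>

definition class_sum :: "'x monomial set \<Rightarrow> ('x, 'k::field) mpoly \<Rightarrow> 'k" where
  "class_sum C p = (\<Sum>u\<in>Poly_Mapping.keys p. Poly_Mapping.lookup p u when u \<in> C)"

lemma class_sum_add: "class_sum C (p + q) = class_sum C p + class_sum C q"
  unfolding class_sum_def by (rule setsum_keys_plus_distrib) (simp_all add: when_add_distrib)

lemma class_sum_sum: "class_sum C (\<Sum>i\<in>I. f i) = (\<Sum>i\<in>I. class_sum C (f i))"
  by (induction I rule: infinite_finite_induct) (simp_all add: class_sum_add class_sum_def[of C 0])

lemma class_sum_single: "class_sum C (Poly_Mapping.single u a) = (a when u \<in> C)"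
  by (simp add: class_sum_def)

text \<open>Expanding \<open>p\<close> into its terms, each term with exponent \<open>u\<close>
  pulls \<open>C\<close> back along the translation by \<open>u\<close>.\<close>

lemma class_sum_mult:
  "class_sum C (p * q) =
    (\<Sum>u\<in>Poly_Mapping.keys p. Poly_Mapping.lookup p u * class_sum {v. u + v \<in> C} q)"
proof -
  have "class_sum C (p * q) = class_sum C
    ((\<Sum>u\<in>Poly_Mapping.keys p. Poly_Mapping.single u (Poly_Mapping.lookup p u)) *
     (\<Sum>v\<in>Poly_Mapping.keys q. Poly_Mapping.single v (Poly_Mapping.lookup q v)))"
    by (simp only: sum_single_lookup)
  also have "\<dots> = (\<Sum>u\<in>Poly_Mapping.keys p. Poly_Mapping.lookup p u * class_sum {v. u + v \<in> C} q)"
    by (simp add: sum_product mult_single class_sum_sum class_sum_single)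
      (simp add: class_sum_def sum_distrib_left mult_when)
  finally show ?thesis .
qed

text \<open>A union of fibres contains both monomials of a generator or neither, so their
  coefficients 1 and -1 contribute 0 in total.\<close>

lemma class_sum_toric_ideal:
  fixes p :: "('x, 'k::field) mpoly"
  assumes "p \<in> toric_ideal R V A"
    and "\<And>u v. u \<in> monomials V \<Longrightarrow> v \<in> monomials V \<Longrightarrow> same_fibre R V A u v \<Longrightarrow>
      u \<in> C \<longleftrightarrow> v \<in> C"
  shows "class_sum C p = 0"
proof -
  interpret R: cring "poly_ring V :: ('x, 'k) mpoly ring"
    by (rule cring_poly_ring)
  let ?sat = "\<lambda>C. \<forall>u\<in>monomials V. \<forall>v\<in>monomials V. same_fibre R V A u v \<longrightarrow> (u \<in> C \<longleftrightarrow> v \<in> C)"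
  \<comment> \<open>All saturated \<open>C\<close> are treated at once: multiplication replaces
    \<open>C\<close> by translates \<open>{v. u + v \<in> C}\<close>, so vanishing for one fixed
    \<open>C\<close> is in general not preserved.\<close>
  let ?S = "{p \<in> carrier (poly_ring V :: ('x, 'k) mpoly ring). \<forall>C. ?sat C \<longrightarrow> class_sum C p = 0}"
  have "toric_ideal R V A \<subseteq> ?S"
    unfolding toric_ideal_eq
  proof (rule R.genideal_minimal)
    show "ideal ?S (poly_ring V)"
    proof (rule ideal_poly_ringI)
      show "p + q \<in> ?S" if "p \<in> ?S" "q \<in> ?S" for p q
      proof -
        have "p + q \<in> carrier (poly_ring V)"
          using that R.a_closed[of p q] by (simp add: poly_ring_def)
        moreover have "class_sum C (p + q) = 0" if "?sat C" for C
          using \<open>p \<in> ?S\<close> \<open>q \<in> ?S\<close> that unfolding class_sum_add by simp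
        ultimately show ?thesis
          by blast
      qed
      show "p * q \<in> ?S" if pq: "p \<in> carrier (poly_ring V)" "q \<in> ?S" for p q
      proof -
        have "class_sum C (p * q) = 0" if C: "?sat C" for C
          unfolding class_sum_mult
        proof (rule sum.neutral, rule ballI)
          fix u assume "u \<in> Poly_Mapping.keys p"
          then have "u \<in> monomials V"
            using pq(1) by (auto simp: poly_ring_def)
          \<comment> \<open>Adding \<open>u\<close> to both monomials does not affect whether they
            share a fibre, so the translate is saturated again.\<close>
          then have "?sat {v. u + v \<in> C}"
            using C by (auto simp: same_fibre_def)
          then have "class_sum {v. u + v \<in> C} q = 0"
            using pq(2) by blast
          then show "Poly_Mapping.lookup p u * class_sum {v. u + v \<in> C} q = 0"
            by simp
        qed
        moreover have "p * q \<in> carrier (poly_ring V)"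
          using pq R.m_closed[of p q] by (simp add: poly_ring_def)
        ultimately show ?thesis
          by blast
      qed
    next
      show "?S \<subseteq> carrier (poly_ring V)"
        by blast
      show "0 \<in> ?S"
        by (simp add: class_sum_def poly_ring_def)
    qed
    have "class_sum C (xpow u - xpow v :: ('x, 'k) mpoly) = 0"
      if "u \<in> monomials V" "v \<in> monomials V" "same_fibre R V A u v" "?sat C" for u v C
    proof -
      have "class_sum C (xpow u - xpow v :: ('x, 'k) mpoly) =
        class_sum C (Poly_Mapping.single u 1 + Poly_Mapping.single v (- 1))"
        by (simp add: xpow_def single_uminus)
      also have "\<dots> = 0"
        unfolding class_sum_add class_sum_single using that by (simp add: when_def)
      finally show ?thesis .
    qed
    then show "{xpow u - xpow v |u v. u \<in> monomials V \<and> v \<in> monomials V \<and> same_fibre R V A u v} \<subseteq> ?S"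
      using toric_generators_in_carrier[of V R A] by blast
  qed
  with assms(1) have "p \<in> ?S"
    by (rule rev_subsetD)
  moreover have "?sat C"
    using assms(2) by simp
  ultimately show ?thesis
    by simp
qed

text \<open>If \<open>u\<close> were the only monomial of \<open>p\<close> in its fibre, the class
  sum of that fibre would be the nonzero coefficient of \<open>u\<close>.\<close>

lemma toric_ideal_other_term:
  assumes p: "p \<in> toric_ideal R V A" and u: "u \<in> Poly_Mapping.keys p"
  shows "\<exists>v\<in>Poly_Mapping.keys p. v \<noteq> u \<and> same_fibre R V A u v"
proof (rule ccontr)
  assume "\<not> ?thesis"
  then have "class_sum {v. same_fibre R V A u v} p =
    (\<Sum>v\<in>Poly_Mapping.keys p. if v = u then Poly_Mapping.lookup p u else 0)"
    unfolding class_sum_def by (intro sum.cong) (auto simp: when_def same_fibre_def)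
  also have "\<dots> = Poly_Mapping.lookup p u"
    using u by simp
  finally have "class_sum {v. same_fibre R V A u v} p \<noteq> 0"
    using u by (simp add: in_keys_iff)
  moreover have "class_sum {v. same_fibre R V A u v} p = 0"
    by (rule class_sum_toric_ideal[OF p]) (auto simp: same_fibre_def)
  ultimately show False
    by contradiction
qed

text \<open>By \<open>toric_ideal_other_term\<close> the initial monomial of an element of the ideal
  is greater than another monomial of its fibre. This reduces the criterion from polynomials to
  pairs of monomials.\<close>

lemma (in monomial_order) toric_groebner_basisI:
  fixes G :: "('x, 'k::field) mpoly set"
  assumes "finite G" "G \<subseteq> toric_ideal R V A"
    and dvd: "\<And>u v. u \<in> monomials V \<Longrightarrow> v \<in> monomials V \<Longrightarrow> same_fibre R V A u v \<Longrightarrow> gt u v \<Longrightarrow>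
      \<exists>g\<in>G. g \<noteq> 0 \<and> mono_dvd (initial gt g) u"
  shows "groebner_basis V gt (toric_ideal R V A) G"
proof (rule groebner_basisI[OF assms(1,2)])
  show carrier: "toric_ideal R V A \<subseteq> carrier (poly_ring V :: ('x, 'k) mpoly ring)"
    using additive_subgroup.a_subset[OF ideal.axioms(1)[OF ideal_toric_ideal]] .
  fix f :: "('x, 'k) mpoly"
  assume f: "f \<in> toric_ideal R V A" "f \<noteq> 0"
  have keys: "Poly_Mapping.keys f \<subseteq> monomials V"
    using f carrier by (auto simp: poly_ring_def)
  note initial = initial_greatest[OF f(2) keys]
  from toric_ideal_other_term[OF f(1) initial(1)]
  show "\<exists>g\<in>G. g \<noteq> 0 \<and> mono_dvd (initial gt g) (initial gt f)"
    using dvd initial keys by (metis subsetD)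
qed

section \<open>Flows on the acyclic tournament\<close>

abbreviation arcs_upto :: "nat \<Rightarrow> (nat \<times> nat) set" where
  "arcs_upto d \<equiv> parcs (acyclic_tournament d)"

abbreviation same_flow :: "nat \<Rightarrow> (nat \<times> nat) monomial \<Rightarrow> (nat \<times> nat) monomial \<Rightarrow> bool" where
  "same_flow d \<equiv> same_fibre (pverts (acyclic_tournament d)) (arcs_upto d)
    (incidence_matrix (acyclic_tournament d))"

abbreviation net_flow :: "nat \<Rightarrow> nat \<Rightarrow> (nat \<times> nat) monomial \<Rightarrow> int" where
  "net_flow d r \<equiv> linear_form (arcs_upto d) (incidence_matrix (acyclic_tournament d) r)"

section \<open>Standard monomials and moves\<close>

definition arc :: "nat \<Rightarrow> nat \<Rightarrow> (nat \<times> nat) monomial" where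
  "arc i j = Poly_Mapping.single (i, j) 1"

definition standard :: "(nat \<times> nat) monomial \<Rightarrow> bool" where
  "standard u \<longleftrightarrow>
    (\<forall>i j k. (i, j) \<in> Poly_Mapping.keys u \<longrightarrow> (j, k) \<notin> Poly_Mapping.keys u) \<and>
    (\<forall>i j k l. (i, l) \<in> Poly_Mapping.keys u \<longrightarrow> (j, k) \<in> Poly_Mapping.keys u \<longrightarrow>
      i < j \<longrightarrow> k < l \<longrightarrow> False)"

text \<open>Each pair consists of the initial and the trailing exponent vector of one binomial of
  the basis. It also serves as a rewriting rule: a chain becomes its shortcut, a nested pair of arcs
  becomes a crossing pair.\<close>

definition moves :: "nat \<Rightarrow> ((nat \<times> nat) monomial \<times> (nat \<times> nat) monomial) set" where
  "moves d =
    {(arc i j + arc j k, arc i k) |i j k. 1 \<le> i \<and> i < j \<and> j < k \<and> k \<le> d} \<union>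
    {(arc i l + arc j k, arc i k + arc j l) |i j k l. 1 \<le> i \<and> i < j \<and> j < k \<and> k < l \<and> l \<le> d}"

lemma in_arcs_upto_iff [simp]: "(i, j) \<in> arcs_upto d \<longleftrightarrow> 1 \<le> i \<and> i < j \<and> j \<le> d"
  by (simp add: acyclic_tournament_def)

lemma finite_arcs_upto [simp]: "finite (arcs_upto d)"
  by (rule finite_subset[of _ "{1..d} \<times> {1..d}"]) (auto simp: acyclic_tournament_def)

lemma incidence_matrix_acyclic_tournament [simp]:
  "incidence_matrix (acyclic_tournament d) r (i, j) = (if r = i then 1 else if r = j then -1 else 0)"
  by (simp add: incidence_matrix_def with_proj_def)

lemma keys_arc [simp]: "Poly_Mapping.keys (arc i j) = {(i, j)}"
  by (simp add: arc_def)

lemma arc_in_monomials_iff [simp]: "arc i j \<in> monomials V \<longleftrightarrow> (i, j) \<in> V"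
  by (simp add: monomials_def)

lemma linear_form_arc [simp]:
  "finite V \<Longrightarrow> (i, j) \<in> V \<Longrightarrow> linear_form V f (arc i j) = f (i, j)"
  unfolding arc_def by (rule linear_form_single)

lemma monomials_arcs_uptoD:
  "u \<in> monomials (arcs_upto d) \<Longrightarrow> (i, j) \<in> Poly_Mapping.keys u \<Longrightarrow> 1 \<le> i \<and> i < j \<and> j \<le> d"
  by (metis in_arcs_upto_iff monomials_def mem_Collect_eq subsetD)

lemma finite_moves: "finite (moves d)"
proof -
  have "moves d \<subseteq>
    (\<lambda>(i, j, k). (arc i j + arc j k, arc i k)) ` ({..d} \<times> {..d} \<times> {..d}) \<union>
    (\<lambda>(i, j, k, l). (arc i l + arc j k, arc i k + arc j l)) ` ({..d} \<times> {..d} \<times> {..d} \<times> {..d})"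
    unfolding moves_def by (intro Un_mono) (force simp: image_iff)+
  then show ?thesis
    by (rule finite_subset) simp
qed

lemma moves_in_monomials:
  "(s, t) \<in> moves d \<Longrightarrow> s \<in> monomials (arcs_upto d) \<and> t \<in> monomials (arcs_upto d)"
  by (auto simp: moves_def)

lemma moves_same_flow: "(s, t) \<in> moves d \<Longrightarrow> same_flow d s t"
  by (auto simp: moves_def same_fibre_def)

text \<open>Used with the real weights \<open>c\<close> and with a natural-valued measure for
  termination, hence the general type of \<open>f\<close>.\<close>

lemma moves_linear_form_less:
  fixes f :: "nat \<times> nat \<Rightarrow> 'b::linordered_semidom"
  assumes "(s, t) \<in> moves d"
    and "\<And>i j k. 1 \<le> i \<Longrightarrow> i < j \<Longrightarrow> j < k \<Longrightarrow> k \<le> d \<Longrightarrow> f (i, j) + f (j, k) > f (i, k)"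
    and "\<And>i j k l. 1 \<le> i \<Longrightarrow> i < j \<Longrightarrow> j < k \<Longrightarrow> k < l \<Longrightarrow> l \<le> d \<Longrightarrow>
      f (i, l) + f (j, k) > f (i, k) + f (j, l)"
  shows "linear_form (arcs_upto d) f t < linear_form (arcs_upto d) f s"
  using assms by (auto simp: moves_def)

text \<open>A single arc, or two crossing arcs, form neither a chain nor a nested pair. Reducedness
  at the trailing monomials rests on this.\<close>

lemma moves_standard: "(s, t) \<in> moves d \<Longrightarrow> standard t"
  by (auto simp: moves_def standard_def keys_plus_nat)

lemma moves_not_standard: "(s, t) \<in> moves d \<Longrightarrow> \<not> standard s"
  unfolding moves_def standard_def by (fastforce simp: keys_plus_nat)

lemma standard_mono: "standard u \<Longrightarrow> Poly_Mapping.keys v \<subseteq> Poly_Mapping.keys u \<Longrightarrow> standard v"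
  unfolding standard_def by (meson subsetD)

lemma moves_not_dvd_standard:
  assumes "(s, t) \<in> moves d" "standard u"
  shows "\<not> mono_dvd s u"
  using assms moves_not_standard standard_mono mono_dvd_keys by blast

text \<open>Both \<open>s\<close> and \<open>s'\<close> are products of two distinct arcs, so
  divisibility forces equal supports. Two arcs form a chain or a nested pair in at most one way,
  which determines the move.\<close>

lemma moves_dvd_unique:
  assumes "(s, t) \<in> moves d" "(s', t') \<in> moves d" "mono_dvd s' s"
  shows "s' = s \<and> t' = t"
  using assms(1,2) mono_dvd_keys[OF assms(3)]
  by (auto simp: moves_def keys_plus_nat)

lemma not_standard_move:
  assumes u: "u \<in> monomials (arcs_upto d)" and "\<not> standard u"
  obtains s t w where "(s, t) \<in> moves d" "u = s + w"
proof -
  note arcs = monomials_arcs_uptoD[OF u]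
  from assms(2) consider
      i j k where "(i, j) \<in> Poly_Mapping.keys u" "(j, k) \<in> Poly_Mapping.keys u"
    | i j k l where "(i, l) \<in> Poly_Mapping.keys u" "(j, k) \<in> Poly_Mapping.keys u" "i < j" "k < l"
    unfolding standard_def by blast
  then show thesis
  proof cases
    case 1
    then obtain w where "u = arc i j + arc j k + w"
      \<comment> \<open>The two arcs are distinct because \<open>i < j\<close>.\<close>
      using split_two_singles[of "(i, j)" u "(j, k)"] arcs[OF 1(1)] unfolding arc_def by auto
    moreover have "(arc i j + arc j k, arc i k) \<in> moves d"
      using arcs[OF 1(1)] arcs[OF 1(2)] by (auto simp: moves_def)
    ultimately show thesis
      using that by blast
  next
    case 2
    then obtain w where "u = arc i l + arc j k + w"
      using split_two_singles[of "(i, l)" u "(j, k)"] unfolding arc_def by auto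
    moreover have "(arc i l + arc j k, arc i k + arc j l) \<in> moves d"
      using arcs[OF 2(1)] arcs[OF 2(2)] 2(3,4) by (auto simp: moves_def)
    ultimately show thesis
      using that by blast
  qed
qed

section \<open>Uniqueness of the standard monomial in a fibre\<close>

text \<open>In a standard monomial no vertex is both a tail and a head, so the terms of row
  \<open>r\<close> all have the same sign and cannot cancel.\<close>

lemma standard_net_flow_pos_iff:
  assumes u: "u \<in> monomials (arcs_upto d)" and "standard u"
  shows "net_flow d r u > 0 \<longleftrightarrow> (\<exists>k. (r, k) \<in> Poly_Mapping.keys u)"
proof
  assume "\<exists>k. (r, k) \<in> Poly_Mapping.keys u"
  then obtain k where k: "(r, k) \<in> Poly_Mapping.keys u" ..
  then have "(i, r) \<notin> Poly_Mapping.keys u" for i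
    using assms(2) by (auto simp: standard_def)
  then show "net_flow d r u > 0"
    unfolding linear_form_def using k monomials_arcs_uptoD[OF u k]
    by (intro sum_pos2[of _ "(r, k)"]) (auto simp: in_keys_iff)
next
  assume pos: "net_flow d r u > 0"
  show "\<exists>k. (r, k) \<in> Poly_Mapping.keys u"
  proof (rule ccontr)
    assume "\<nexists>k. (r, k) \<in> Poly_Mapping.keys u"
    then have "net_flow d r u \<le> 0"
      unfolding linear_form_def by (intro sum_nonpos) (auto simp: in_keys_iff)
    with pos show False
      by simp
  qed
qed

lemma standard_net_flow_neg_iff:
  assumes u: "u \<in> monomials (arcs_upto d)" and "standard u"
  shows "net_flow d r u < 0 \<longleftrightarrow> (\<exists>i. (i, r) \<in> Poly_Mapping.keys u)"
proof
  assume "\<exists>i. (i, r) \<in> Poly_Mapping.keys u"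
  then obtain i where i: "(i, r) \<in> Poly_Mapping.keys u" ..
  then have "(r, k) \<notin> Poly_Mapping.keys u" for k
    using assms(2) by (auto simp: standard_def)
  \<comment> \<open>The signs are reversed so that \<open>sum_pos2\<close> applies to a sum of
    nonnegative terms.\<close>
  then have "0 < (\<Sum>a\<in>arcs_upto d. - (incidence_matrix (acyclic_tournament d) r a *
      int (Poly_Mapping.lookup u a)))"
    using i monomials_arcs_uptoD[OF u i]
    by (intro sum_pos2[of _ "(i, r)"]) (auto simp: in_keys_iff)
  then show "net_flow d r u < 0"
    by (simp add: linear_form_def sum_negf)
next
  assume neg: "net_flow d r u < 0"
  show "\<exists>i. (i, r) \<in> Poly_Mapping.keys u"
  proof (rule ccontr)
    assume "\<nexists>i. (i, r) \<in> Poly_Mapping.keys u"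
    then have "net_flow d r u \<ge> 0"
      unfolding linear_form_def by (intro sum_nonneg) (auto simp: in_keys_iff)
    with neg show False
      by simp
  qed
qed

text \<open>Otherwise the arc leaving the least tail would enclose the arc entering the least head.\<close>

lemma standard_least_arc:
  assumes "standard u" "u \<noteq> 0"
  shows "(LEAST i. \<exists>k. (i, k) \<in> Poly_Mapping.keys u, LEAST k. \<exists>i. (i, k) \<in> Poly_Mapping.keys u)
    \<in> Poly_Mapping.keys u" (is "(?i, ?k) \<in> _")
proof -
  have "Poly_Mapping.keys u \<noteq> {}"
    using assms(2) by simp
  then obtain i k where ik: "(i, k) \<in> Poly_Mapping.keys u"
    by (metis ex_in_conv surj_pair)
  have "\<exists>l. (?i, l) \<in> Poly_Mapping.keys u"
    using ik by (intro LeastI) blast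
  then obtain l where l: "(?i, l) \<in> Poly_Mapping.keys u" ..
  have "\<exists>j. (j, ?k) \<in> Poly_Mapping.keys u"
    using ik by (intro LeastI[of "\<lambda>k. \<exists>i. (i, k) \<in> Poly_Mapping.keys u"]) blast
  then obtain j where j: "(j, ?k) \<in> Poly_Mapping.keys u" ..
  have "?i \<le> j" "?k \<le> l"
    using j l by (auto intro: Least_le)
  moreover have "\<not> (?i < j \<and> ?k < l)"
    using assms(1) j l unfolding standard_def by blast
  ultimately show ?thesis
    using j l by (metis le_neq_implies_less)
qed

lemma standard_unique:
  assumes "u \<in> monomials (arcs_upto d)" "v \<in> monomials (arcs_upto d)"
    and "standard u" "standard v" "same_flow d u v"
  shows "u = v"
  using assms
\<comment> \<open>With all coefficients 1 the linear form is the total degree, which drops when the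
  common arc is cancelled.\<close>
proof (induction "linear_form (arcs_upto d) (\<lambda>_. 1 :: nat) u" arbitrary: u v rule: less_induct)
  case less
  have flow: "net_flow d r u = net_flow d r v" if "1 \<le> r" "r \<le> d" for r
    using less.prems(5) that by (simp add: same_fibre_def acyclic_tournament_def)
  note pos = standard_net_flow_pos_iff[OF less.prems(1,3)] standard_net_flow_pos_iff[OF less.prems(2,4)]
    and neg = standard_net_flow_neg_iff[OF less.prems(1,3)] standard_net_flow_neg_iff[OF less.prems(2,4)]
  note arcs = monomials_arcs_uptoD[OF less.prems(1)] monomials_arcs_uptoD[OF less.prems(2)]
  have tails: "(\<exists>k. (i, k) \<in> Poly_Mapping.keys u) \<longleftrightarrow> (\<exists>k. (i, k) \<in> Poly_Mapping.keys v)" for i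
  \<comment> \<open>Equality of flows is available only at the vertices of the tournament; any other
    number is an end of no arc in either support.\<close>
  proof (cases "1 \<le> i \<and> i \<le> d")
    case True
    then show ?thesis
      using pos[of i] flow[of i] by simp
  next
    case False
    then show ?thesis
      using arcs by (meson less_imp_le order_trans)
  qed
  have heads: "(\<exists>i. (i, k) \<in> Poly_Mapping.keys u) \<longleftrightarrow> (\<exists>i. (i, k) \<in> Poly_Mapping.keys v)" for k
  proof (cases "1 \<le> k \<and> k \<le> d")
    case True
    then show ?thesis
      using neg[of k] flow[of k] by simp
  next
    case False
    then show ?thesis
      using arcs by (meson less_imp_le order_trans)
  qed
  show ?case
  proof (cases "u = 0")
    case True
    then have "Poly_Mapping.keys v = {}"
      using tails by (auto simp del: keys_eq_empty)
    with True show ?thesis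
      by simp
  next
    case False
    then obtain i k where "(i, k) \<in> Poly_Mapping.keys u"
      by (metis ex_in_conv surj_pair keys_eq_empty)
    with tails have "v \<noteq> 0"
      by auto
    define i where "i = (LEAST i. \<exists>k. (i, k) \<in> Poly_Mapping.keys u)"
    define k where "k = (LEAST k. \<exists>i. (i, k) \<in> Poly_Mapping.keys u)"
    \<comment> \<open>Tails and heads agree for \<open>u\<close> and \<open>v\<close>, so both
      monomials have the same least tail and the same least head.\<close>
    have ik: "(i, k) \<in> Poly_Mapping.keys u" "(i, k) \<in> Poly_Mapping.keys v"
      using standard_least_arc[OF less.prems(3) False] standard_least_arc[OF less.prems(4) \<open>v \<noteq> 0\<close>]
      by (simp_all add: i_def k_def tails heads)
    obtain u' where u': "u = arc i k + u'"
      using split_single[OF ik(1)] unfolding arc_def by blast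
    obtain v' where v': "v = arc i k + v'"
      using split_single[OF ik(2)] unfolding arc_def by blast
    have "u' = v'"
    proof (rule less.hyps)
      show "linear_form (arcs_upto d) (\<lambda>_. 1 :: nat) u' < linear_form (arcs_upto d) (\<lambda>_. 1) u"
        using less.prems(1) by (simp add: u')
      show "standard u'"
        by (rule standard_mono[OF less.prems(3)]) (auto simp: u' keys_plus_nat)
      show "standard v'"
        by (rule standard_mono[OF less.prems(4)]) (auto simp: v' keys_plus_nat)
    qed (use less.prems in \<open>simp_all add: u' v' same_fibre_def\<close>)
    with u' v' show ?thesis
      by simp
  qed
qed

section \<open>Reduction to a standard monomial of smaller weight\<close>

text \<open>Repeated moves end in a standard monomial. Each one keeps the fibre and lowers the
  weight, so the alternative \<open>v = u\<close> arises only when \<open>u\<close> is already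
  standard.\<close>

lemma ex_standard_below:
  fixes c :: "nat \<times> nat \<Rightarrow> real"
  assumes "u \<in> monomials (arcs_upto d)"
    and c: "\<And>s t. (s, t) \<in> moves d \<Longrightarrow>
      linear_form (arcs_upto d) c t < linear_form (arcs_upto d) c s"
  shows "\<exists>v\<in>monomials (arcs_upto d). standard v \<and> same_flow d u v \<and>
    (v = u \<or> linear_form (arcs_upto d) c v < linear_form (arcs_upto d) c u)"
proof -
  \<comment> \<open>The weights \<open>c\<close> are real and may be negative, so termination needs another measure.\<close>
  define f :: "nat \<times> nat \<Rightarrow> nat" where "f = (\<lambda>(i, j). 2 * d\<^sup>2 - i * j)"
  \<comment> \<open>Since \<open>i * j\<close> is at most \<open>d\<^sup>2\<close>, no subtraction
    is truncated and every arc has measure at least \<open>d\<^sup>2\<close>. Two arcs of a chain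
    thus total at least \<open>2 * d\<^sup>2\<close>, which exceeds the measure of the
    shortcut.\<close>
  have f: "linear_form (arcs_upto d) f t < linear_form (arcs_upto d) f s" if st: "(s, t) \<in> moves d" for s t
  proof (rule moves_linear_form_less[OF st])
    have le: "i * j \<le> d\<^sup>2" if "i \<le> d" "j \<le> d" for i j
      using that by (simp add: power2_eq_square mult_le_mono)
    show "f (i, k) < f (i, j) + f (j, k)" if "1 \<le> i" "i < j" "j < k" "k \<le> d" for i j k
    proof -
      have "0 < i * k" "i * k \<le> d\<^sup>2" "i * j \<le> d\<^sup>2" "j * k \<le> d\<^sup>2"
        using that le by simp_all
      then show ?thesis
        unfolding f_def prod.case by linarith
    qed
    show "f (i, k) + f (j, l) < f (i, l) + f (j, k)"
      if "1 \<le> i" "i < j" "j < k" "k < l" "l \<le> d" for i j k l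
    proof -
      \<comment> \<open>The difference of the two sides is \<open>(j - i) * (l - k)\<close>, that is
        \<open>Suc p * Suc q\<close>, which is positive.\<close>
      obtain p q where "j = i + Suc p" "l = k + Suc q"
        using \<open>i < j\<close> \<open>k < l\<close> by (metis add_Suc_right less_iff_Suc_add)
      then have "i * l + j * k < i * k + j * l"
        by (simp add: algebra_simps)
      then show ?thesis
        using le[of i l] le[of j k] le[of i k] le[of j l] that by (simp add: f_def)
    qed
  qed
  show ?thesis
    using assms(1)
  proof (induction "linear_form (arcs_upto d) f u" arbitrary: u rule: less_induct)
    case less
    show ?case
    proof (cases "standard u")
      case True
      with less.prems show ?thesis
        by (auto simp: same_fibre_def)
    next
      case False
      then obtain s t w where st: "(s, t) \<in> moves d" "u = s + w"
        using not_standard_move[OF less.prems] by blast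
      have "t + w \<in> monomials (arcs_upto d)"
        using less.prems st(2) moves_in_monomials[OF st(1)] by simp
      then obtain v where v: "v \<in> monomials (arcs_upto d)" "standard v" "same_flow d (t + w) v"
        "v = t + w \<or> linear_form (arcs_upto d) c v < linear_form (arcs_upto d) c (t + w)"
        using less.hyps[of "t + w"] f[OF st(1)] st(2) by auto
      moreover have "same_flow d u (t + w)"
        using moves_same_flow[OF st(1)] st(2) by (simp add: same_fibre_def)
      then have "same_flow d u v"
        using v(3) by (simp add: same_fibre_def)
      moreover have "linear_form (arcs_upto d) c v < linear_form (arcs_upto d) c u"
        using v(4) c[OF st(1)] st(2) by auto
      ultimately show ?thesis
        by blast
    qed
  qed
qed

section \<open>The reduced Groebner basis\<close>

lemma xvar_mult: "xvar a * xvar b = xpow (Poly_Mapping.single a 1 + Poly_Mapping.single b 1)"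
  by (simp add: xvar_def xpow_def mult_single)

lemma moves_binomials:
  "(\<lambda>(s, t). xpow s - xpow t :: (nat \<times> nat, 'k::field) mpoly) ` moves d =
    {xvar (i, j) * xvar (j, k) - xvar (i, k) |i j k. 1 \<le> i \<and> i < j \<and> j < k \<and> k \<le> d} \<union>
    {xvar (i, l) * xvar (j, k) - xvar (i, k) * xvar (j, l) |i j k l.
      1 \<le> i \<and> i < j \<and> j < k \<and> k < l \<and> l \<le> d}"
  unfolding xvar_mult unfolding xvar_def arc_def[symmetric] moves_def image_Un
  by (intro arg_cong2[of _ _ _ _ "(\<union>)"]) (auto simp: image_iff, blast+)

text \<open>The equivalence in \<open>H\<close> expresses both that the displayed set is a reduced
  Groebner basis and that it is the only one.\<close>

theorem theorem4p8:
  fixes d :: nat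
    and gt :: "(nat \<times> nat) monomial \<Rightarrow> (nat \<times> nat) monomial \<Rightarrow> bool"
    and c :: "nat \<times> nat \<Rightarrow> real"
    and H :: "(nat \<times> nat, 'k::field) mpoly set"
  defines "V \<equiv> parcs (acyclic_tournament d)"
    and "A \<equiv> incidence_matrix (acyclic_tournament d)"
  assumes "term_order V gt"
    and "\<And>i j k. 1 \<le> i \<Longrightarrow> i < j \<Longrightarrow> j < k \<Longrightarrow> k \<le> d \<Longrightarrow> c (i, j) + c (j, k) > c (i, k)"
    and "\<And>i j k l. 1 \<le> i \<Longrightarrow> i < j \<Longrightarrow> j < k \<Longrightarrow> k < l \<Longrightarrow> l \<le> d \<Longrightarrow>
      c (i, l) + c (j, k) > c (i, k) + c (j, l)"
  shows "reduced_groebner_basis V (refine c gt)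
      (toric_ideal (pverts (acyclic_tournament d)) V A) H \<longleftrightarrow>
    H = {xvar (i, j) * xvar (j, k) - xvar (i, k) |i j k. 1 \<le> i \<and> i < j \<and> j < k \<and> k \<le> d} \<union>
        {xvar (i, l) * xvar (j, k) - xvar (i, k) * xvar (j, l) |i j k l.
          1 \<le> i \<and> i < j \<and> j < k \<and> k < l \<and> l \<le> d}"
proof -
  define I :: "(nat \<times> nat, 'k) mpoly set" where
    "I = toric_ideal (pverts (acyclic_tournament d)) V A"
  define G :: "(nat \<times> nat, 'k) mpoly set" where "G = (\<lambda>(s, t). xpow s - xpow t) ` moves d"
  have order: "monomial_order V gt"
    using assms(3) unfolding term_order_def by unfold_locales blast+
  \<comment> \<open>Weights are compared first and \<open>gt\<close> breaks ties; such a
    lexicographic combination is again a strict linear order.\<close>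
  interpret monomial_order V "refine c gt"
  proof
    show "\<not> refine c gt u u" if "u \<in> monomials V" for u
      using that monomial_order.irrefl[OF order] by (simp add: refine_def)
    show "refine c gt u w" if "u \<in> monomials V" "v \<in> monomials V" "w \<in> monomials V"
      "refine c gt u v" "refine c gt v w" for u v w
      using that monomial_order.trans[OF order] unfolding refine_def by (metis less_trans)
    show "refine c gt u v \<or> refine c gt v u" if "u \<in> monomials V" "v \<in> monomials V" "u \<noteq> v" for u v
      using that monomial_order.total[OF order] unfolding refine_def by (metis linorder_less_linear)
  qed
  have weight: "weight c u = linear_form V c u" if "u \<in> monomials V" for u
    using that by (intro weight_eq_linear_form) (simp_all add: V_def)
  have c: "linear_form V c t < linear_form V c s" if "(s, t) \<in> moves d" for s t
    unfolding V_def using that assms(4,5) by (rule moves_linear_form_less)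
  have moves: "s \<in> monomials V" "t \<in> monomials V" "refine c gt s t" if "(s, t) \<in> moves d" for s t
    using moves_in_monomials[OF that] c[OF that] weight by (simp_all add: V_def refine_def)
  note binomial = initial_binomial[OF moves, where 'k = 'k]
  have "groebner_basis V (refine c gt) I G"
    unfolding I_def
  proof (rule toric_groebner_basisI)
    show "finite G"
      by (simp add: G_def finite_moves)
    show "G \<subseteq> toric_ideal (pverts (acyclic_tournament d)) V A"
      using moves moves_same_flow unfolding G_def V_def A_def
      by (auto intro!: binomial_in_toric_ideal)
    fix u v
    assume uv: "u \<in> monomials V" "v \<in> monomials V"
      "same_fibre (pverts (acyclic_tournament d)) V A u v" "refine c gt u v"
    \<comment> \<open>A standard \<open>u\<close> would be the standard monomial \<open>v'\<close>
      reached from \<open>v\<close>. Then \<open>u\<close> equals \<open>v\<close> or has smaller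
      weight than \<open>v\<close>, against \<open>refine c gt u v\<close>.\<close>
    have "\<not> standard u"
    proof
      assume u: "standard u"
      obtain v' where v': "v' \<in> monomials V" "standard v'" "same_flow d v v'"
        "v' = v \<or> linear_form V c v' < linear_form V c v"
        using ex_standard_below[of v d c] uv(2) c unfolding V_def by blast
      have "same_flow d u v'"
        using uv(3) v'(3) by (simp add: same_fibre_def V_def A_def)
      then have "u = v'"
        using standard_unique[of u d v'] uv(1) v'(1,2) u by (simp add: V_def)
      with v'(4) show False
        using uv irrefl[of u] weight by (auto simp: refine_def)
    qed
    then obtain s t w where st: "(s, t) \<in> moves d" "u = s + w"
      using not_standard_move uv(1) unfolding V_def by blast
    show "\<exists>g\<in>G. g \<noteq> 0 \<and> mono_dvd (initial (refine c gt) g) u"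
    proof (intro bexI conjI)
      show "xpow s - xpow t \<in> G"
        using st(1) by (force simp: G_def)
      show "xpow s - xpow t \<noteq> (0 :: (nat \<times> nat, 'k) mpoly)"
        using binomial(1)[OF st(1) st(1) st(1)] by force
      show "mono_dvd (initial (refine c gt) (xpow s - xpow t :: (nat \<times> nat, 'k) mpoly)) u"
        using binomial(3)[OF st(1) st(1) st(1)] st(2) by (auto simp: mono_dvd_def)
    qed
  qed
  moreover have "\<forall>g\<in>G. g \<noteq> 0 \<and> Poly_Mapping.lookup g (initial (refine c gt) g) = 1 \<and>
      (\<forall>h\<in>G. \<forall>u\<in>Poly_Mapping.keys g. h \<noteq> g \<or> u \<noteq> initial (refine c gt) g \<longrightarrow>
        \<not> mono_dvd (initial (refine c gt) h) u)"
  proof (intro ballI conjI impI)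
    fix g assume "g \<in> G"
    then obtain s t where st: "(s, t) \<in> moves d" and g: "g = xpow s - xpow t"
      by (auto simp: G_def)
    note g_binomial = binomial[OF st st st, folded g]
    show "g \<noteq> 0"
      using g_binomial(1) by force
    show "Poly_Mapping.lookup g (initial (refine c gt) g) = 1"
      by (simp add: g_binomial)
    fix h u
    assume "h \<in> G" and u: "u \<in> Poly_Mapping.keys g" "h \<noteq> g \<or> u \<noteq> initial (refine c gt) g"
    then obtain s' t' where st': "(s', t') \<in> moves d" and h: "h = xpow s' - xpow t'"
      by (auto simp: G_def)
    note h_binomial = binomial[OF st' st' st', folded h]
    \<comment> \<open>The monomials of \<open>g\<close> are \<open>s\<close> and \<open>t\<close>.
      The trailing one is standard and has no initial monomial as a divisor; the initial one is
      divisible only by itself, which is the case excluded by \<open>u\<close>.\<close>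
    have "\<not> mono_dvd s' t"
      using st' moves_standard[OF st] by (rule moves_not_dvd_standard)
    moreover have "mono_dvd s' s \<Longrightarrow> h = g"
      using moves_dvd_unique[OF st st'] g h by simp
    ultimately show "\<not> mono_dvd (initial (refine c gt) h) u"
      using u by (auto simp: g_binomial h_binomial)
  qed
  ultimately have G: "reduced_groebner_basis V (refine c gt) I G"
    unfolding reduced_groebner_basis_def by blast
  have "reduced_groebner_basis V (refine c gt) I H \<longleftrightarrow> H = G"
    using G reduced_groebner_basis_unique[OF _ G] ideal_toric_ideal unfolding I_def by blast
  then show ?thesis
    unfolding I_def G_def moves_binomials .
qed

end
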